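(* Let $\varrho_\alpha:L_d^\infty\to\mathbb{C}$, $\alpha\in(0,1]$, be a family of homogeneous risk measures, all associated with $f$, such that $\varrho_\alpha(X)\succeq\varrho_\beta(X)$ for all $X$ whenever $\alpha\geq\beta$. Let $$\mathrm{D}^\alpha(X)=\{y\in\mathbb{R}^d:\ \varrho_\alpha(X-y)\preceq\mathbf{e}\}$$ be the depth-trimmed regions generated by this family, and let $$s_\alpha(X)=\bigvee\{f(y):\ y\in\mathbb{R}^d,\ f(\mathrm{D}^\alpha(X-y)\oplus K)\subseteq\mathbb{A}\}$$ be the risk measure induced by these depth-trimmed regions. If $\mathbb{F}=\{f(y):y\in\mathbb{R}^d\}$ is both sup-generating and inf-generating, i.e. for all $b\in\mathbb{C}$ $$b=\bigvee\{a\in\mathbb{F}:a\preceq b\}\quad\text{and}\quad b=\bigwedge\{a\in\mathbb{F}:b\preceq a\},$$ then $s_\alpha(X)=\varrho_\alpha(X)$ for all $X\in L_d^\infty$ and $\alpha\in(0,1]$.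
   Context: $L_d^\infty$ is the set of essentially bounded $d$-dimensional random vectors on a probability space; $\mathbb{R}^d$ is embedded in it as the constants. Convex cone: $\mathbb{C}$ is a topological space with a commutative, associative, continuous operation $\oplus$ with neutral element $\mathbf{e}$, and a continuous multiplication $(x,t)\mapsto t\odot x$ by scalars $t>0$ with $1\odot x=x$, $t\odot\mathbf{e}=\mathbf{e}$, $t\odot(x\oplus y)=t\odot x\oplus t\odot y$, $t\odot(s\odot x)=(ts)\odot x$. $\mathbb{C}$ carries a partial order $\preceq$ such that $x\preceq y$ implies $x\oplus z\preceq y\oplus z$ for all $z$ and $t\odot x\preceq t\odot y$ for all $t>0$; with it $\mathbb{C}$ is a complete lattice (supremum $\bigvee$, infimum $\bigwedge$) whose top element $\mathbb{T}$ is absorbing ($\mathbb{T}\oplus a=\mathbb{T}$ for all $a$). $K\subsetneq\mathbb{R}^d$ is a closed proper Euclidean convex cone: $\mathbb{R}^d_+\subseteq K$, $K$ contains no line, and $x+y\in K$, $tx\in K$ for $x,y\in K$, $t>0$. Write $x\leq_K y$ iff $y-x\in K$. $f:\mathbb{R}^d\to\mathbb{C}$ satisfies $f(0)=\mathbf{e}$, $f(x)\oplus f(y)=f(x+y)$ for all $x,y$, and $f(y)\preceq f(x)$ whenever $y\leq_K x$. The acceptance cone is $\mathbb{A}=\{a\in\mathbb{C}:\mathbf{e}\preceq a\}$, and it is assumed that $f(x)\in\mathbb{A}$ if and only if $0\leq_K x$. A functional $\varrho:L_d^\infty\to\mathbb{C}$ is a homogeneous risk measure associated with $f$ if $\varrho(X)=f(x)$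 whenever $X=x$ a.s., and (R1) $f(y)\oplus\varrho(X)=\varrho(X+y)$ for all $y\in\mathbb{R}^d$; (R2) $\varrho(Y)\preceq\varrho(X)$ whenever $Y\leq_K X$ a.s.; (R3) $\varrho(tX)=t\odot\varrho(X)$ for all $t>0$. For subsets of $\mathbb{R}^d$, $A\oplus B$ denotes the closed Minkowski sum, i.e. the closure of $\{x+y:x\in A,y\in B\}$. For $S\subseteq\mathbb{R}^d$, $f(S)=\{f(x):x\in S\}$. *)

theory Defs
  imports "HOL-Probability.Probability"
begin

text \<open>
  The type classes of \<open>'c\<close> supply the continuous commutative monoid
  \<open>(\<oplus>, e) = (+, 0)\<close>, the partial order compatible with it, and the complete lattice.
  Only multiplication by scalars \<open>t > 0\<close> is meaningful; the values of \<open>smul\<close> at other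
  scalars are unconstrained. No separation axiom and no relation between topology and order
  is imposed.
\<close>

locale lattice_convex_cone =
  fixes smul :: "real \<Rightarrow> 'c \<Rightarrow>
    'c::{topological_comm_monoid_add, ordered_comm_monoid_add, complete_lattice}"
  assumes smul_continuous: "continuous_on (UNIV \<times> {0<..}) (\<lambda>(x, t). smul t x)"
    and smul_one: "smul 1 x = x"
    and smul_zero: "t > 0 \<Longrightarrow> smul t 0 = 0"
    and smul_add: "t > 0 \<Longrightarrow> smul t (x + y) = smul t x + smul t y"
    and smul_smul: "t > 0 \<Longrightarrow> s > 0 \<Longrightarrow> smul t (smul s x) = smul (t * s) x"
    and smul_mono: "t > 0 \<Longrightarrow> x \<le> y \<Longrightarrow> smul t x \<le> smul t y"
    and top_absorbing: "top + a = (top :: 'c)"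

definition acceptance_cone :: "'c::{zero, ord} set" where
  "acceptance_cone = {a. 0 \<le> a}"

definition proper_euclidean_cone :: "(real ^ 'n) set \<Rightarrow> bool" where
  "proper_euclidean_cone K \<longleftrightarrow>
     K \<noteq> UNIV \<and> closed K \<and> {x. \<forall>i. 0 \<le> x $ i} \<subseteq> K \<and>
     (\<nexists>x v. v \<noteq> 0 \<and> (\<forall>t::real. x + t *\<^sub>R v \<in> K)) \<and>
     (\<forall>x\<in>K. \<forall>y\<in>K. x + y \<in> K) \<and> (\<forall>x\<in>K. \<forall>t>0. t *\<^sub>R x \<in> K)"

definition cone_le :: "(real ^ 'n) set \<Rightarrow> real ^ 'n \<Rightarrow> real ^ 'n \<Rightarrow> bool" where
  "cone_le K x y \<longleftrightarrow> y - x \<in> K"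

definition cone_embedding ::
    "(real ^ 'n) set \<Rightarrow> (real ^ 'n \<Rightarrow> 'c::{comm_monoid_add, ord}) \<Rightarrow> bool" where
  "cone_embedding K f \<longleftrightarrow>
     f 0 = 0 \<and> (\<forall>x y. f x + f y = f (x + y)) \<and>
     (\<forall>x y. cone_le K y x \<longrightarrow> f y \<le> f x) \<and>
     (\<forall>x. f x \<in> acceptance_cone \<longleftrightarrow> cone_le K 0 x)"

text \<open>Random vectors are functions, not classes modulo almost sure equality; a functional
  satisfying (R2) below cannot distinguish almost surely equal vectors, since \<open>0 \<in> K\<close>.\<close>

definition Linfty :: "'a measure \<Rightarrow> ('a \<Rightarrow> real ^ 'n) set" where
  "Linfty M = {X \<in> borel_measurable M. \<exists>c. AE w in M. norm (X w) \<le> c}"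

definition homogeneous_risk_measure ::
    "'a measure \<Rightarrow> (real ^ 'n) set \<Rightarrow> (real \<Rightarrow> 'c \<Rightarrow> 'c) \<Rightarrow>
     (real ^ 'n \<Rightarrow> 'c::{comm_monoid_add, ord}) \<Rightarrow> (('a \<Rightarrow> real ^ 'n) \<Rightarrow> 'c) \<Rightarrow> bool" where
  "homogeneous_risk_measure M K smul f \<rho> \<longleftrightarrow>
     (\<forall>X\<in>Linfty M. \<forall>x. (AE w in M. X w = x) \<longrightarrow> \<rho> X = f x) \<and>
     (\<forall>X\<in>Linfty M. \<forall>y. f y + \<rho> X = \<rho> (\<lambda>w. X w + y)) \<and>
     (\<forall>X\<in>Linfty M. \<forall>Y\<in>Linfty M. (AE w in M. cone_le K (Y w) (X w)) \<longrightarrow> \<rho> Y \<le> \<rho> X) \<and>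
     (\<forall>X\<in>Linfty M. \<forall>t>0. \<rho> (\<lambda>w. t *\<^sub>R X w) = smul t (\<rho> X))"

definition closed_minkowski_sum ::
    "(real ^ 'n) set \<Rightarrow> (real ^ 'n) set \<Rightarrow> (real ^ 'n) set" where
  "closed_minkowski_sum A B = closure {x + y | x y. x \<in> A \<and> y \<in> B}"

definition depth_trimmed_region ::
    "(('a \<Rightarrow> real ^ 'n) \<Rightarrow> 'c::{zero, ord}) \<Rightarrow> ('a \<Rightarrow> real ^ 'n) \<Rightarrow> (real ^ 'n) set" where
  "depth_trimmed_region \<rho> X = {y. \<rho> (\<lambda>w. X w - y) \<le> 0}"

definition induced_risk_measure ::
    "(real ^ 'n) set \<Rightarrow> (real ^ 'n \<Rightarrow> 'c::{zero, complete_lattice}) \<Rightarrow>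
     (('a \<Rightarrow> real ^ 'n) \<Rightarrow> (real ^ 'n) set) \<Rightarrow> ('a \<Rightarrow> real ^ 'n) \<Rightarrow> 'c" where
  "induced_risk_measure K f D X =
     Sup {f y | y. f ` closed_minkowski_sum (D (\<lambda>w. X w - y)) K \<subseteq> acceptance_cone}"

definition sup_generating :: "'c::complete_lattice set \<Rightarrow> bool" where
  "sup_generating F \<longleftrightarrow> (\<forall>b. b = Sup {a \<in> F. a \<le> b})"

definition inf_generating :: "'c::complete_lattice set \<Rightarrow> bool" where
  "inf_generating F \<longleftrightarrow> (\<forall>b. b = Inf {a \<in> F. b \<le> a})"

end

theory Submission
  imports Defs
begin

text \<open>
  By translation invariance, a point \<open>z\<close> lies in the depth-trimmed region of \<open>X - y\<close> iff
  \<open>\<rho> X \<le> f (y + z)\<close>, so the region is contained in \<open>K\<close> iff \<open>f y\<close> is a lower bound of all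
  elements of \<open>range f\<close> above \<open>\<rho> X\<close>. If \<open>range f\<close> is inf-generating, this says \<open>f y \<le> \<rho> X\<close>,
  and if it is sup-generating, the supremum of all such \<open>f y\<close> is \<open>\<rho> X\<close>.
\<close>

lemma zero_in_proper_euclidean_cone: "proper_euclidean_cone K \<Longrightarrow> 0 \<in> K"
  by (auto simp: proper_euclidean_cone_def subset_iff)

text \<open>Since \<open>0 \<in> K\<close>, the sum contains \<open>A\<close>. Conversely,
  \<open>K\<close> absorbs sums of its own elements and is topologically closed, so neither adding
  \<open>K\<close> nor taking the closure leads out of it.\<close>

lemma closed_minkowski_sum_subset_cone_iff:
  assumes K: "proper_euclidean_cone K"
  shows "closed_minkowski_sum A K \<subseteq> K \<longleftrightarrow> A \<subseteq> K"
proof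
  assume sub: "closed_minkowski_sum A K \<subseteq> K"
  have "x \<in> closed_minkowski_sum A K" if "x \<in> A" for x
  proof -
    have "x + 0 \<in> {x + y | x y. x \<in> A \<and> y \<in> K}"
      using that zero_in_proper_euclidean_cone[OF K] by blast
    then have "x + 0 \<in> closed_minkowski_sum A K"
      unfolding closed_minkowski_sum_def by (rule subsetD[OF closure_subset])
    then show ?thesis by simp
  qed
  then show "A \<subseteq> K" using sub by blast
next
  assume "A \<subseteq> K"
  show "closed_minkowski_sum A K \<subseteq> K"
    unfolding closed_minkowski_sum_def
  proof (rule closure_minimal)
    have "\<forall>x\<in>K. \<forall>y\<in>K. x + y \<in> K"
      using K unfolding proper_euclidean_cone_def by (elim conjE)
    with \<open>A \<subseteq> K\<close> show "{x + y | x y. x \<in> A \<and> y \<in> K} \<subseteq> K" by blast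
    show "closed K"
      using K unfolding proper_euclidean_cone_def by (elim conjE)
  qed
qed

lemma cone_embedding_image_subset_acceptance_cone_iff:
  assumes "cone_embedding K f"
  shows "f ` S \<subseteq> acceptance_cone \<longleftrightarrow> S \<subseteq> K"
  using assms unfolding cone_embedding_def cone_le_def by auto

text \<open>The target is only a monoid, but \<open>f\<close> is a homomorphism from a group, so
  \<open>f v\<close> has the additive inverse \<open>f (- v)\<close>. Adding it is therefore an
  order automorphism and can be undone.\<close>

lemma cone_embedding_translate_le_iff:
  fixes f :: "real ^ 'n \<Rightarrow> 'c::ordered_comm_monoid_add"
  assumes "cone_embedding K f"
  shows "f v + a \<le> b \<longleftrightarrow> a \<le> f (- v) + b"
proof -
  have f0: "f 0 = 0" and add: "\<And>x y. f x + f y = f (x + y)"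
    using assms by (auto simp: cone_embedding_def)
  have cancel: "f v + (f (- v) + c) = c" "f (- v) + (f v + c) = c" for c
    by (simp_all add: add.assoc[symmetric] add f0)
  show ?thesis
    \<comment> \<open>The first instance gives the forward implication, the second the
      converse.\<close>
    using add_left_mono[of "f v + a" b "f (- v)"] add_left_mono[of a "f (- v) + b" "f v"]
    by (auto simp: cancel)
qed

text \<open>Cancelling the invertible \<open>f x\<close> leaves \<open>0 \<le> f z\<close>, which
  the acceptance condition turns into \<open>z \<in> K\<close>. Thus \<open>f\<close> reflects the
  cone order as well as preserving it.\<close>

lemma cone_embedding_le_iff:
  fixes f :: "real ^ 'n \<Rightarrow> 'c::ordered_comm_monoid_add"
  assumes "cone_embedding K f"
  shows "f x \<le> f (x + z) \<longleftrightarrow> z \<in> K"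
proof -
  have "f x \<le> f (x + z) \<longleftrightarrow> 0 \<le> f (- x) + f (x + z)"
    using cone_embedding_translate_le_iff[OF assms, of x 0 "f (x + z)"] by simp
  then show ?thesis
    using assms by (simp add: cone_embedding_def acceptance_cone_def cone_le_def)
qed

lemma mem_depth_trimmed_region_translate_iff:
  fixes f :: "real ^ 'n \<Rightarrow> 'c::ordered_comm_monoid_add"
  assumes f: "cone_embedding K f"
    and \<rho>: "homogeneous_risk_measure M K smul f \<rho>"
    and X: "X \<in> Linfty M"
  shows "z \<in> depth_trimmed_region \<rho> (\<lambda>w. X w - y) \<longleftrightarrow> \<rho> X \<le> f (y + z)"
proof -
  \<comment> \<open>Both shifts are merged into one added constant, the form in which (R1) extracts
    it from \<rho>.\<close>
  have "\<rho> (\<lambda>w. X w - y - z) = \<rho> (\<lambda>w. X w + (- (y + z)))"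
    by (rule arg_cong[of _ _ \<rho>]) (simp add: algebra_simps)
  also have "\<dots> = f (- (y + z)) + \<rho> X"
    using \<rho> X unfolding homogeneous_risk_measure_def by simp
  finally show ?thesis
    using cone_embedding_translate_le_iff[OF f, of "- (y + z)" "\<rho> X" 0]
    by (simp only: depth_trimmed_region_def mem_Collect_eq minus_minus add_0_right)
qed

text \<open>Being below the infimum \<open>b\<close> of a set means being a lower bound of that set,
  so testing against \<open>F\<close> suffices.\<close>

lemma inf_generating_le_iff:
  assumes "inf_generating F"
  shows "a \<le> b \<longleftrightarrow> (\<forall>c\<in>F. b \<le> c \<longrightarrow> a \<le> c)"
proof -
  have "b = Inf {c \<in> F. b \<le> c}"
    using assms unfolding inf_generating_def by blast
  then have "a \<le> b \<longleftrightarrow> a \<le> Inf {c \<in> F. b \<le> c}"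
    by simp
  then show ?thesis by (auto simp: le_Inf_iff)
qed

lemma induced_risk_measure_eq:
  fixes f :: "real ^ 'n \<Rightarrow> 'c::{ordered_comm_monoid_add, complete_lattice}"
  assumes K: "proper_euclidean_cone K"
    and f: "cone_embedding K f"
    and \<rho>: "homogeneous_risk_measure M K smul f \<rho>"
    and sup: "sup_generating (range f)"
    and inf: "inf_generating (range f)"
    and X: "X \<in> Linfty M"
  shows "induced_risk_measure K f (depth_trimmed_region \<rho>) X = \<rho> X"
proof -
  have "f ` closed_minkowski_sum (depth_trimmed_region \<rho> (\<lambda>w. X w - y)) K \<subseteq> acceptance_cone
      \<longleftrightarrow> f y \<le> \<rho> X" (is "?L \<longleftrightarrow> _") for y
  proof -
    have "?L \<longleftrightarrow> (\<forall>z. \<rho> X \<le> f (y + z) \<longrightarrow> f y \<le> f (y + z))"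
      using mem_depth_trimmed_region_translate_iff[OF f \<rho> X]
      by (auto simp: cone_embedding_image_subset_acceptance_cone_iff[OF f]
          closed_minkowski_sum_subset_cone_iff[OF K] cone_embedding_le_iff[OF f])
    \<comment> \<open>As \<open>z\<close> varies, \<open>y + z\<close> reaches every vector
      \<open>x\<close>, namely for \<open>z = x - y\<close>; the test set becomes all of
      \<open>range f\<close>, as inf-generation requires.\<close>
    also have "\<dots> \<longleftrightarrow> (\<forall>x. \<rho> X \<le> f x \<longrightarrow> f y \<le> f x)"
    proof (intro iffI allI)
      fix x assume "\<forall>z. \<rho> X \<le> f (y + z) \<longrightarrow> f y \<le> f (y + z)"
      from this[rule_format, of "x - y"] show "\<rho> X \<le> f x \<longrightarrow> f y \<le> f x" by simp
    qed simp
    also have "\<dots> \<longleftrightarrow> f y \<le> \<rho> X"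
      using inf_generating_le_iff[OF inf, of "f y" "\<rho> X"] by simp
    finally show ?thesis .
  qed
  then have "induced_risk_measure K f (depth_trimmed_region \<rho>) X = Sup {f y | y. f y \<le> \<rho> X}"
    by (simp add: induced_risk_measure_def)
  also have "{f y | y. f y \<le> \<rho> X} = {a \<in> range f. a \<le> \<rho> X}"
    by blast
  also have "Sup \<dots> = \<rho> X"
    using sup[unfolded sup_generating_def, rule_format, of "\<rho> X"] by (rule sym)
  finally show ?thesis .
qed

theorem mainTheorem6:
  fixes M :: "'a measure"
    and K :: "(real ^ 'n) set"
    and smul :: "real \<Rightarrow> 'c \<Rightarrow>
      'c::{topological_comm_monoid_add, ordered_comm_monoid_add, complete_lattice}"
    and f :: "real ^ 'n \<Rightarrow> 'c"
    and \<rho> :: "real \<Rightarrow> ('a \<Rightarrow> real ^ 'n) \<Rightarrow> 'c"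
  assumes "prob_space M"
    and "lattice_convex_cone smul"
    and "proper_euclidean_cone K"
    and "cone_embedding K f"
    and "\<And>\<alpha>. \<alpha> \<in> {0<..1} \<Longrightarrow> homogeneous_risk_measure M K smul f (\<rho> \<alpha>)"
    and "\<And>\<alpha> \<beta> X. \<alpha> \<in> {0<..1} \<Longrightarrow> \<beta> \<in> {0<..1} \<Longrightarrow> \<alpha> \<ge> \<beta> \<Longrightarrow> X \<in> Linfty M \<Longrightarrow>
           \<rho> \<alpha> X \<ge> \<rho> \<beta> X"
    and "sup_generating (range f)"
    and "inf_generating (range f)"
  shows "\<forall>X \<in> Linfty M. \<forall>\<alpha> \<in> {0<..1}.
           induced_risk_measure K f (depth_trimmed_region (\<rho> \<alpha>)) X = \<rho> \<alpha> X"
  using induced_risk_measure_eq[OF assms(3,4) assms(5) assms(7,8)] by simp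

end
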